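(* Let $3\le p<q$ be relatively prime integers, $n\ge 3$, and let $H=\langle p,q,h_1,\dots,h_{n-2}\rangle\in KW(p,q)$, where $h_i=pq-x_ip-y_iq$ for $1\le i\le n-2$ with positive integers $x_1<x_2<\dots<x_{n-2}$ and $y_1>y_2>\dots>y_{n-2}$ satisfying $2x_i\le q$ and $2y_i\le p$ for all $i$. Let $k$ be a field. Then the defining ideal $I_H\subseteq k[u,v,u_1,\dots,u_{n-2}]$ of the semigroup ring $k[H]$ is the ideal generated by all the $2\times 2$ minors of the following $2\times 3$ matrices: $$A_{ij}=\begin{bmatrix} u_i & u^{q-2x_j}v^{p-y_i-y_j} & u_j\\ u^{x_j-x_i} & u_j & v^{y_i-y_j}\end{bmatrix},\qquad 1\le i<j\le n-2,$$ $$B=\begin{bmatrix} v^{y_{n-2}} & u^{q-x_1-x_{n-2}} & u_1\\ u^{x_1} & u_{n-2} & v^{p-y_1-y_{n-2}}\end{bmatrix},$$ $$C=\begin{bmatrix} u^{q-x_1-x_{n-2}}v^{p-2y_1} & u_1 & u_{n-2}\\ u_1 & u^{x_{n-2}-x_1} & v^{y_1-y_{n-2}}\end{bmatrix}.$$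
   Context: $\langle a_1,\dots,a_n\rangle$ denotes the submonoid of the nonnegative integers generated by $a_1,\dots,a_n$. The class $KW(p,q)$: for coprime integers $3\le p<q$, $KW(p,q)$ is the set of all numerical semigroups $H$ with $\langle p,q\rangle\subseteq H\subseteq\langle p,q,r\rangle$, where $r=p/2$ if $p$ is even, $r=q/2$ if $q$ is even, and $r=(p+q)/2$ if $p$ and $q$ are both odd. The defining ideal: let $S=k[u,v,u_1,\dots,u_{n-2}]$ be a polynomial ring and $\phi:S\to k[t]$ the $k$-algebra map with $u\mapsto t^p$, $v\mapsto t^q$, $u_i\mapsto t^{h_i}$ for $1\le i\le n-2$. The semigroup ring is $k[H]=k[t^p,t^q,t^{h_1},\dots,t^{h_{n-2}}]=\phi(S)$, and $I_H=\ker\phi$. *)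

theory Defs
  imports
    "HOL-Library.Poly_Mapping"
    "HOL-Algebra.Algebraic_Closure_Type"
    "Jordan_Normal_Form.Determinant"
    "Jordan_Normal_Form.DL_Submatrix"
begin

hide_const (open) up_ring.monom

definition additive_submonoid :: "nat set \<Rightarrow> bool" where
  "additive_submonoid M \<longleftrightarrow> 0 \<in> M \<and> (\<forall>a\<in>M. \<forall>b\<in>M. a + b \<in> M)"

definition submonoid_generated :: "nat set \<Rightarrow> nat set" where
  "submonoid_generated A = additive_submonoid hull A"

definition numerical_semigroup :: "nat set \<Rightarrow> bool" where
  "numerical_semigroup H \<longleftrightarrow> additive_submonoid H \<and> finite (- H)"

text \<open>For coprime \<open>p\<close> and \<open>q\<close> at most one of them is even, and every division below is exact.\<close>

definition KW_half :: "nat \<Rightarrow> nat \<Rightarrow> nat" where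
  "KW_half p q = (if even p then p div 2 else if even q then q div 2 else (p + q) div 2)"

definition KW :: "nat \<Rightarrow> nat \<Rightarrow> nat set set" where
  "KW p q = {H. numerical_semigroup H \<and> submonoid_generated {p, q} \<subseteq> H \<and>
                H \<subseteq> submonoid_generated {p, q, KW_half p q}}"

text \<open>A polynomial is a finitely supported map from monomials, themselves finitely supported
  maps from variables to exponents, to coefficients.\<close>

type_synonym ('x, 'a) mpoly = "('x \<Rightarrow>\<^sub>0 nat) \<Rightarrow>\<^sub>0 'a"

definition mvar :: "'x \<Rightarrow> ('x, 'a::comm_ring_1) mpoly" where
  "mvar x = Poly_Mapping.single (Poly_Mapping.single x 1) 1"

definition mpoly_vars :: "('x, 'a::zero) mpoly \<Rightarrow> 'x set" where
  "mpoly_vars f = (\<Union>m\<in>Poly_Mapping.keys f. Poly_Mapping.keys m)"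

text \<open>The polynomial ring in the variables from \<open>A\<close>, as a subring of the polynomial ring in all
  variables of type \<open>'x\<close>.\<close>

definition mpoly_ring :: "'x set \<Rightarrow> ('x, 'a::comm_ring_1) mpoly ring" where
  "mpoly_ring A = ring_of_type_algebra \<lparr> carrier := {f. mpoly_vars f \<subseteq> A} \<rparr>"

text \<open>The homomorphism of algebras over the coefficient ring that sends each variable \<open>x\<close> to \<open>g x\<close>.\<close>

definition mpoly_subst :: "('x \<Rightarrow> 'a::comm_ring_1 poly) \<Rightarrow> ('x, 'a) mpoly \<Rightarrow> 'a poly" where
  "mpoly_subst g f =
     (\<Sum>m\<in>Poly_Mapping.keys f.
        smult (Poly_Mapping.lookup f m) (\<Prod>x\<in>Poly_Mapping.keys m. g x ^ Poly_Mapping.lookup m x))"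

lemma mpoly_vars_plus: "mpoly_vars (f + g) \<subseteq> mpoly_vars f \<union> mpoly_vars g"
  unfolding mpoly_vars_def using Poly_Mapping.keys_add[of f g] by blast

lemma mpoly_vars_uminus [simp]: "mpoly_vars (- f) = mpoly_vars (f :: ('x, 'a::comm_ring_1) mpoly)"
  unfolding mpoly_vars_def by simp

lemma mpoly_vars_times:
  "mpoly_vars (f * g) \<subseteq> mpoly_vars f \<union> mpoly_vars (g :: ('x, 'a::comm_ring_1) mpoly)"
proof
  fix x assume "x \<in> mpoly_vars (f * g)"
  then obtain m where m: "m \<in> Poly_Mapping.keys (f * g)" "x \<in> Poly_Mapping.keys m"
    by (auto simp: mpoly_vars_def)
  from m(1) obtain a b where ab: "m = a + b" "a \<in> Poly_Mapping.keys f" "b \<in> Poly_Mapping.keys g"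
    using Poly_Mapping.keys_mult[of f g] by blast
  have "x \<in> Poly_Mapping.keys a \<union> Poly_Mapping.keys b"
    using m(2) ab(1) Poly_Mapping.keys_add[of a b] by blast
  thus "x \<in> mpoly_vars f \<union> mpoly_vars g"
    using ab by (auto simp: mpoly_vars_def)
qed

lemma mpoly_vars_mvar [simp]: "mpoly_vars (mvar x :: ('x, 'a::comm_ring_1) mpoly) = {x}"
  by (simp add: mpoly_vars_def mvar_def)

lemma mpoly_ring_simps:
  "carrier (mpoly_ring A) = {f. mpoly_vars f \<subseteq> A}"
  "f \<otimes>\<^bsub>mpoly_ring A\<^esub> g = f * g" "f \<oplus>\<^bsub>mpoly_ring A\<^esub> g = f + g"
  "\<one>\<^bsub>mpoly_ring A\<^esub> = 1" "\<zero>\<^bsub>mpoly_ring A\<^esub> = 0"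
  by (simp_all add: mpoly_ring_def ring_of_type_algebra_def)

lemma cring_mpoly_ring: "cring (mpoly_ring A :: ('x, 'a::comm_ring_1) mpoly ring)"
proof (rule cringI)
  have "mpoly_vars (f + g) \<subseteq> A" "mpoly_vars (f * g) \<subseteq> A"
    if "mpoly_vars f \<subseteq> A" "mpoly_vars g \<subseteq> A" for f g :: "('x, 'a) mpoly"
    using mpoly_vars_plus[of f g] mpoly_vars_times[of f g] that by blast+
  note closed = this
  have [simp]: "mpoly_vars (0 :: ('x, 'a) mpoly) = {}" "mpoly_vars (1 :: ('x, 'a) mpoly) = {}"
    by (simp_all add: mpoly_vars_def)
  show "abelian_group (mpoly_ring A :: ('x, 'a) mpoly ring)"
  proof (rule abelian_groupI)
    fix f :: "('x, 'a) mpoly" assume "f \<in> carrier (mpoly_ring A)"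
    thus "\<exists>g\<in>carrier (mpoly_ring A). g \<oplus>\<^bsub>mpoly_ring A\<^esub> f = \<zero>\<^bsub>mpoly_ring A\<^esub>"
      by (intro bexI[of _ "- f"]) (auto simp: mpoly_ring_simps)
  qed (simp_all add: mpoly_ring_simps closed add_ac)
  show "Group.comm_monoid (mpoly_ring A :: ('x, 'a) mpoly ring)"
    by (rule Group.comm_monoidI) (simp_all add: mpoly_ring_simps closed mult_ac)
qed (simp add: mpoly_ring_simps algebra_simps)

lemma mpoly_subst_superset:
  assumes "finite A" "Poly_Mapping.keys f \<subseteq> A"
  shows "mpoly_subst g f =
     (\<Sum>m\<in>A. smult (Poly_Mapping.lookup f m)
        (\<Prod>x\<in>Poly_Mapping.keys m. g x ^ Poly_Mapping.lookup m x))"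
  unfolding mpoly_subst_def
  by (rule sum.mono_neutral_left) (use assms in \<open>auto simp: in_keys_iff\<close>)

lemma mpoly_subst_plus: "mpoly_subst g (f1 + f2) = mpoly_subst g f1 + mpoly_subst g f2"
proof -
  let ?A = "Poly_Mapping.keys f1 \<union> Poly_Mapping.keys f2"
  show ?thesis
    using Poly_Mapping.keys_add[of f1 f2]
    by (simp add: mpoly_subst_superset[of ?A] lookup_add smult_add_left sum.distrib)
qed

lemma mpoly_subst_0 [simp]: "mpoly_subst g 0 = 0"
  by (simp add: mpoly_subst_def)

lemma mpoly_subst_sum: "mpoly_subst g (sum f A) = (\<Sum>a\<in>A. mpoly_subst g (f a))"
  by (induction A rule: infinite_finite_induct) (auto simp: mpoly_subst_plus)

lemma mpoly_subst_single:
  "mpoly_subst g (Poly_Mapping.single m c) =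
     smult c (\<Prod>x\<in>Poly_Mapping.keys m. g x ^ Poly_Mapping.lookup m x)"
  by (cases "c = 0") (auto simp: mpoly_subst_def)

lemma mpoly_subst_mvar [simp]: "mpoly_subst g (mvar x) = g x"
  by (simp add: mvar_def mpoly_subst_single)

lemma mpoly_subst_1 [simp]: "mpoly_subst g 1 = 1"
  using mpoly_subst_single[of g 0 1] by simp

lemma prod_power_keys_plus:
  fixes g :: "'x \<Rightarrow> 'a::comm_ring_1 poly" and a b :: "'x \<Rightarrow>\<^sub>0 nat"
  shows "(\<Prod>x\<in>Poly_Mapping.keys (a + b). g x ^ Poly_Mapping.lookup (a + b) x) =
    (\<Prod>x\<in>Poly_Mapping.keys a. g x ^ Poly_Mapping.lookup a x) *
    (\<Prod>x\<in>Poly_Mapping.keys b. g x ^ Poly_Mapping.lookup b x)"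
proof -
  let ?A = "Poly_Mapping.keys a \<union> Poly_Mapping.keys b"
  have *: "(\<Prod>x\<in>Poly_Mapping.keys c. g x ^ Poly_Mapping.lookup c x) =
      (\<Prod>x\<in>?A. g x ^ Poly_Mapping.lookup c x)" if "Poly_Mapping.keys c \<subseteq> ?A" for c :: "'x \<Rightarrow>\<^sub>0 nat"
    by (rule prod.mono_neutral_left) (use that in \<open>auto simp: in_keys_iff\<close>)
  show ?thesis
    unfolding *[OF Poly_Mapping.keys_add] *[OF Un_upper1] *[OF Un_upper2]
    by (simp add: lookup_add power_add prod.distrib)
qed

lemma mpoly_as_sum:
  "f = (\<Sum>m\<in>Poly_Mapping.keys f. Poly_Mapping.single m (Poly_Mapping.lookup f m))"
  by (rule poly_mapping_eqI)
     (auto simp: lookup_sum lookup_single when_def in_keys_iff sum.delta')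

lemma mpoly_subst_times: "mpoly_subst g (f1 * f2) = mpoly_subst g f1 * mpoly_subst g f2"
proof -
  let ?c = "\<lambda>m. \<Prod>x\<in>Poly_Mapping.keys m. g x ^ Poly_Mapping.lookup m x"
  have "f1 * f2 = (\<Sum>a\<in>Poly_Mapping.keys f1. \<Sum>b\<in>Poly_Mapping.keys f2.
      Poly_Mapping.single (a + b) (Poly_Mapping.lookup f1 a * Poly_Mapping.lookup f2 b))"
    by (subst (1) mpoly_as_sum[of f1], subst (1) mpoly_as_sum[of f2])
       (simp add: sum_product Poly_Mapping.mult_single)
  also have "mpoly_subst g \<dots> = (\<Sum>a\<in>Poly_Mapping.keys f1. \<Sum>b\<in>Poly_Mapping.keys f2.
      smult (Poly_Mapping.lookup f1 a) (?c a) * smult (Poly_Mapping.lookup f2 b) (?c b))"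
    by (simp add: mpoly_subst_sum mpoly_subst_single prod_power_keys_plus mult.commute)
  also have "\<dots> = mpoly_subst g f1 * mpoly_subst g f2"
    by (simp add: mpoly_subst_def sum_product)
  finally show ?thesis .
qed

lemma mpoly_subst_ring_hom:
  "ring_hom_cring (mpoly_ring A) (ring_of_type_algebra :: 'a::comm_ring_1 poly ring) (mpoly_subst g)"
proof (intro ring_hom_cring.intro ring_hom_cring_axioms.intro cring_mpoly_ring cring_from_type_algebra)
  show "mpoly_subst g \<in> Ring.ring_hom (mpoly_ring A) (ring_of_type_algebra :: 'a poly ring)"
    by (rule ring_hom_memI)
       (auto simp: mpoly_ring_simps ring_of_type_algebra_def mpoly_subst_plus mpoly_subst_times)
qed

text \<open>\<open>U\<close>, \<open>V\<close> and \<open>W i\<close> name the variables \<open>u\<close>, \<open>v\<close> and \<open>u\<^sub>i\<close>; the indices \<open>i\<close> run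
  over \<open>{1..n - 2}\<close>.\<close>

datatype gen_var = U | V | W nat

definition S_vars :: "nat \<Rightarrow> gen_var set" where
  "S_vars n = {U, V} \<union> W ` {1..n - 2}"

definition S_ring :: "nat \<Rightarrow> (gen_var, 'k::field) mpoly ring" where
  "S_ring n = mpoly_ring (S_vars n)"

fun weight :: "nat \<Rightarrow> nat \<Rightarrow> (nat \<Rightarrow> nat) \<Rightarrow> gen_var \<Rightarrow> nat" where
  "weight p q h U = p"
| "weight p q h V = q"
| "weight p q h (W i) = h i"

definition phi :: "nat \<Rightarrow> nat \<Rightarrow> (nat \<Rightarrow> nat) \<Rightarrow> (gen_var, 'k::field) mpoly \<Rightarrow> 'k poly" where
  "phi p q h = mpoly_subst (\<lambda>z. Polynomial.monom 1 (weight p q h z))"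

definition defining_ideal ::
  "nat \<Rightarrow> nat \<Rightarrow> nat \<Rightarrow> (nat \<Rightarrow> nat) \<Rightarrow> (gen_var, 'k::field) mpoly set" where
  "defining_ideal n p q h = a_kernel (S_ring n) ring_of_type_algebra (phi p q h)"

definition minors :: "nat \<Rightarrow> 'a::comm_ring_1 mat \<Rightarrow> 'a set" where
  "minors r M = {det (submatrix M I J) | I J.
     I \<subseteq> {..<dim_row M} \<and> card I = r \<and> J \<subseteq> {..<dim_col M} \<and> card J = r}"

lemma det_2_mat: "det (mat 2 2 f) = f (0, 0) * f (1, 1) - f (0, 1) * (f (1, 0) :: 'a::comm_ring_1)"
proof -
  let ?M = "mat 2 2 f"
  have "det ?M = (\<Sum>i<2. ?M $$ (i, 0) * cofactor ?M i 0)"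
    by (rule laplace_expansion_column) auto
  also have "\<dots> = ?M $$ (0, 0) * cofactor ?M 0 0 + ?M $$ (1, 0) * cofactor ?M 1 0"
    by (simp add: numeral_2_eq_2)
  moreover have "cofactor ?M 0 0 = f (1, 1)" "cofactor ?M 1 0 = - f (0, 1)"
    unfolding cofactor_def by (subst det_single; simp add: mat_delete_def)+
  ultimately show ?thesis
    by (simp add: algebra_simps)
qed

lemma card_2_subset_3: "J \<subseteq> {..<3} \<and> card J = 2 \<longleftrightarrow> J \<in> {{0, 1}, {0, 2}, {1, 2::nat}}"
proof
  assume J: "J \<subseteq> {..<3} \<and> card J = 2"
  then obtain a b where ab: "J = {a, b}" "a \<noteq> b"
    by (auto simp: card_2_iff)
  with J have "a \<in> {0, 1, 2}" "b \<in> {0, 1, 2}"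
    by auto
  with ab show "J \<in> {{0, 1}, {0, 2}, {1, 2}}"
    by (auto simp: insert_commute)
qed auto

lemma card_2_subset_2: "I \<subseteq> {..<2} \<and> card I = 2 \<longleftrightarrow> I = {0, 1::nat}"
proof
  assume "I \<subseteq> {..<2} \<and> card I = 2"
  hence "I = {..<2}"
    by (intro card_subset_eq) auto
  thus "I = {0, 1}"
    by auto
qed auto

lemma pick_pair:
  assumes "a < (b::nat)"
  shows "pick {a, b} 0 = a" "pick {a, b} (Suc 0) = b"
proof -
  show *: "pick {a, b} 0 = a"
    unfolding pick.simps by (rule Least_equality) (use assms in auto)
  show "pick {a, b} (Suc 0) = b"
    unfolding pick.simps(2) * by (rule Least_equality) (use assms in auto)
qed

lemma submatrix_2_mat:
  assumes "dim_row M = 2" "a < b" "b < dim_col M"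
  shows "submatrix M {0, 1} {a, b} = mat 2 2 (\<lambda>(i, j). M $$ (i, if j = 0 then a else b))"
proof -
  have "{i. i < 2 \<and> i \<in> {0, 1::nat}} = {0, 1}" "{j. j < dim_col M \<and> j \<in> {a, b}} = {a, b}"
    using assms by auto
  hence cards: "card {i. i < dim_row M \<and> i \<in> {0, 1::nat}} = 2"
      "card {j. j < dim_col M \<and> j \<in> {a, b}} = 2"
    using assms by auto
  show ?thesis
    unfolding submatrix_def cards
    by (rule eq_matI)
       (use assms in \<open>auto simp: less_2_cases_iff pick_pair[of 0 "Suc 0"] pick_pair[OF assms(2)]
          simp del: pick.simps\<close>)
qed

lemma minors_2_dim_2_3:
  assumes "dim_row M = 2" "dim_col M = 3"
  shows "minors 2 M = {det (submatrix M {0, 1} {0, 1}), det (submatrix M {0, 1} {0, 2}),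
    det (submatrix M {0, 1} {1, 2})}"
proof -
  have "minors 2 M = {det (submatrix M I J) | I J.
      (I \<subseteq> {..<2} \<and> card I = 2) \<and> (J \<subseteq> {..<3} \<and> card J = 2)}"
    unfolding minors_def assms conj_assoc by (rule refl)
  also have "\<dots> = {det (submatrix M I J) | I J. I = {0, 1} \<and> J \<in> {{0, 1}, {0, 2}, {1, 2}}}"
    by (simp only: card_2_subset_2 card_2_subset_3)
  also have "\<dots> = (\<lambda>J. det (submatrix M {0, 1} J)) ` {{0, 1}, {0, 2}, {1, 2}}"
    unfolding image_def Bex_def by (intro Collect_cong) metis
  finally show ?thesis
    by (simp only: image_insert image_empty)
qed

lemma minors_2_mat_of_rows_list:
  "minors 2 (mat_of_rows_list 3 [[a, b, c], [d, e, f]]) =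
     {a * e - b * d, a * f - c * d, b * f - c * (e :: 'a::comm_ring_1)}"
proof -
  define M where "M = mat_of_rows_list 3 [[a, b, c], [d, e, f]]"
  have dims: "dim_row M = 2" "dim_col M = 3"
    by (simp_all add: M_def mat_of_rows_list_def)
  have entries: "M $$ (0, 0) = a" "M $$ (0, 1) = b" "M $$ (0, 2) = c"
      "M $$ (1, 0) = d" "M $$ (1, 1) = e" "M $$ (1, 2) = f"
    by (simp_all add: M_def mat_of_rows_list_def)
  have *: "det (submatrix M {0, 1} {r, s}) = M $$ (0, r) * M $$ (1, s) - M $$ (0, s) * M $$ (1, r)"
    if "r < s" "s < 3" for r s
    by (subst submatrix_2_mat) (use that in \<open>simp_all add: dims det_2_mat\<close>)
  have "det (submatrix M {0, 1} {0, 1}) = a * e - b * d"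
    using *[of 0 1] entries by simp
  moreover have "det (submatrix M {0, 1} {0, 2}) = a * f - c * d"
    using *[of 0 2] entries by simp
  moreover have "det (submatrix M {0, 1} {1, 2}) = b * f - c * e"
    using *[of 1 2] entries by simp
  ultimately show ?thesis
    using minors_2_dim_2_3[OF dims] by (simp only: M_def)
qed

text \<open>The natural-number subtractions in the exponents are exact under the conditions
  \<open>2 * x i \<le> q\<close>, \<open>2 * y i \<le> p\<close>, \<open>x\<close> increasing and \<open>y\<close> decreasing on \<open>{1..n - 2}\<close>, and
  \<open>i < j\<close>.\<close>

definition matrix_A ::
  "nat \<Rightarrow> nat \<Rightarrow> (nat \<Rightarrow> nat) \<Rightarrow> (nat \<Rightarrow> nat) \<Rightarrow> nat \<Rightarrow> nat \<Rightarrow> (gen_var, 'k::field) mpoly mat" where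
  "matrix_A p q x y i j = (let u = mvar U; v = mvar V; w = (\<lambda>l. mvar (W l)) in
     mat_of_rows_list 3
       [[w i,             u ^ (q - 2 * x j) * v ^ (p - y i - y j), w j],
        [u ^ (x j - x i), w j,                                     v ^ (y i - y j)]])"

definition matrix_B ::
  "nat \<Rightarrow> nat \<Rightarrow> nat \<Rightarrow> (nat \<Rightarrow> nat) \<Rightarrow> (nat \<Rightarrow> nat) \<Rightarrow> (gen_var, 'k::field) mpoly mat" where
  "matrix_B n p q x y = (let u = mvar U; v = mvar V; w = (\<lambda>l. mvar (W l)) in
     mat_of_rows_list 3
       [[v ^ y (n - 2), u ^ (q - x 1 - x (n - 2)), w 1],
        [u ^ x 1,       w (n - 2),                 v ^ (p - y 1 - y (n - 2))]])"

definition matrix_C ::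
  "nat \<Rightarrow> nat \<Rightarrow> nat \<Rightarrow> (nat \<Rightarrow> nat) \<Rightarrow> (nat \<Rightarrow> nat) \<Rightarrow> (gen_var, 'k::field) mpoly mat" where
  "matrix_C n p q x y = (let u = mvar U; v = mvar V; w = (\<lambda>l. mvar (W l)) in
     mat_of_rows_list 3
       [[u ^ (q - x 1 - x (n - 2)) * v ^ (p - 2 * y 1), w 1,                   w (n - 2)],
        [w 1,                                           u ^ (x (n - 2) - x 1), v ^ (y 1 - y (n - 2))]])"

end

theory Submission
  imports Defs
begin

text \<open>
  The kernel of \<open>\<phi>\<close> is spanned by the differences of two monomials of equal weight, so it is
  enough to show that monomials of equal weight are congruent modulo the ideal \<open>J\<close> of the minors
  (\<open>mpoly_ideal.kernel_subset\<close>); that each minor lies in the kernel is a comparison of weights.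

  The minors become uniform with the convention \<open>x\<^sub>0 = 0\<close>, \<open>y\<^sub>0 = p\<close>,
  \<open>u\<^sub>0 = 1\<close>, which is consistent because \<open>pq - 0 p - p q = 0\<close> is the weight of \<open>1\<close>. With
  \<open>m = n - 2\<close> they say that, modulo \<open>J\<close>,

  \<^item> \<open>u\<^sub>i u\<^sub>j = u^(q - x\<^sub>i - x\<^sub>j) v^(p - y\<^sub>i - y\<^sub>j)\<close> for \<open>1 \<le> i \<le> j \<le> m\<close>,
  \<^item> \<open>v^(y\<^sub>i - y\<^sub>j) u\<^sub>i = u^(x\<^sub>j - x\<^sub>i) u\<^sub>j\<close> for \<open>0 \<le> i < j \<le> m\<close>,
  \<^item> \<open>u^(q - x\<^sub>m) = v^y\<^sub>m u\<^sub>m\<close>.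

  By the relations of the first kind every monomial is congruent to a normal form
  \<open>u^a v^b u\<^sub>i\<close> with \<open>0 \<le> i \<le> m\<close> (\<open>normalizable_single\<close>). The weight of such a normal form
  is \<open>pq + (a - x\<^sub>i) p + (b - y\<^sub>i) q\<close>, so, \<open>p\<close> and \<open>q\<close> being coprime, two normal forms have the
  same weight exactly when their vectors \<open>(a - x\<^sub>i, b - y\<^sub>i)\<close> differ by \<open>t (q, -p)\<close> for an
  integer \<open>t\<close>. If \<open>t = 0\<close>, the two are connected by a relation of the second kind
  (\<open>normal_same\<close>). If \<open>t > 0\<close>, then \<open>u\<close> occurs in the first normal form with
  an exponent of at least \<open>q - x\<^sub>m\<close>, and the third relation lowers \<open>t\<close>
  (\<open>normal_shift\<close>). The case \<open>t < 0\<close> follows by symmetry.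
\<close>

section \<open>Polynomials in a set of variables\<close>

lemma mpoly_vars_1 [simp]: "mpoly_vars (1 :: ('x, 'a::comm_ring_1) mpoly) = {}"
  by (simp add: mpoly_vars_def)

lemma mpoly_vars_times_subset:
  fixes f g :: "('x, 'a::comm_ring_1) mpoly"
  shows "mpoly_vars f \<subseteq> A \<Longrightarrow> mpoly_vars g \<subseteq> A \<Longrightarrow> mpoly_vars (f * g) \<subseteq> A"
  using mpoly_vars_times[of f g] by blast

lemma mpoly_vars_power_subset:
  fixes f :: "('x, 'a::comm_ring_1) mpoly"
  shows "mpoly_vars f \<subseteq> A \<Longrightarrow> mpoly_vars (f ^ k) \<subseteq> A"
  by (induction k) (simp_all add: mpoly_vars_times_subset)

lemma mpoly_vars_diff_subset:
  fixes f g :: "('x, 'a::comm_ring_1) mpoly"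
  shows "mpoly_vars f \<subseteq> A \<Longrightarrow> mpoly_vars g \<subseteq> A \<Longrightarrow> mpoly_vars (f - g) \<subseteq> A"
  using mpoly_vars_plus[of f "- g"] by auto

lemma mpoly_vars_single_subset:
  "Poly_Mapping.keys m \<subseteq> A \<Longrightarrow> mpoly_vars (Poly_Mapping.single m c) \<subseteq> A"
  by (auto simp: mpoly_vars_def)

lemma mpoly_subst_diff: "mpoly_subst g (f1 - f2) = mpoly_subst g f1 - mpoly_subst g f2"
  using mpoly_subst_plus[of g "f1 - f2" f2] by simp

lemma mpoly_subst_power: "mpoly_subst g (f ^ k) = mpoly_subst g f ^ k"
  by (induction k) (simp_all add: mpoly_subst_times)

lemma mvar_power: "(mvar z :: ('x, 'a::comm_ring_1) mpoly) ^ k =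
    Poly_Mapping.single (Poly_Mapping.single z k) 1"
  by (induction k) (simp_all add: mvar_def Poly_Mapping.mult_single single_add[symmetric])

lemma single_sum:
  "Poly_Mapping.single m (sum F B) = (\<Sum>i\<in>B. Poly_Mapping.single m (F i :: 'a::comm_monoid_add))"
  by (induction B rule: infinite_finite_induct) (simp_all add: single_add)

lemma prod_single_one:
  "(\<Prod>z\<in>B. Poly_Mapping.single (F z) (1 :: 'a::comm_ring_1)) =
    Poly_Mapping.single (\<Sum>z\<in>B. F z :: 'x \<Rightarrow>\<^sub>0 nat) 1"
  by (induction B rule: infinite_finite_induct) (simp_all add: Poly_Mapping.mult_single)

lemma single_as_prod_mvar:
  "Poly_Mapping.single m (1 :: 'a::comm_ring_1) =
    (\<Prod>z\<in>Poly_Mapping.keys m. mvar z ^ Poly_Mapping.lookup m z)"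
  by (simp add: mvar_power prod_single_one mpoly_as_sum[symmetric])

section \<open>Congruence modulo an ideal, and kernels of monomial maps\<close>

locale mpoly_ideal =
  fixes A :: "'x set" and J :: "('x, 'a::comm_ring_1) mpoly set"
  assumes ideal: "ideal J (mpoly_ring A)"
begin

lemma zero_mem: "0 \<in> J"
  using additive_subgroup.zero_closed[OF ideal.axioms(1)[OF ideal]] by (simp add: mpoly_ring_simps)

lemma add_mem: "f \<in> J \<Longrightarrow> g \<in> J \<Longrightarrow> f + g \<in> J"
  using additive_subgroup.a_closed[OF ideal.axioms(1)[OF ideal]] by (simp add: mpoly_ring_simps)

lemma mult_mem: "mpoly_vars c \<subseteq> A \<Longrightarrow> f \<in> J \<Longrightarrow> c * f \<in> J"
  using ideal.I_l_closed[OF ideal, of f c] by (simp add: mpoly_ring_simps)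

lemma uminus_mem: "f \<in> J \<Longrightarrow> - f \<in> J"
  using mult_mem[of "- 1" f] by simp

lemma sum_mem: "(\<And>i. i \<in> B \<Longrightarrow> F i \<in> J) \<Longrightarrow> sum F B \<in> J"
  by (induction B rule: infinite_finite_induct) (auto intro: zero_mem add_mem)

definition cong_mod (infix "\<simeq>\<^sub>J" 50) where "f \<simeq>\<^sub>J g \<longleftrightarrow> f - g \<in> J"

lemma cong_refl: "f \<simeq>\<^sub>J f"
  by (simp add: cong_mod_def zero_mem)

lemma cong_sym: "f \<simeq>\<^sub>J g \<Longrightarrow> g \<simeq>\<^sub>J f"
  using uminus_mem[of "f - g"] by (simp add: cong_mod_def)

lemma cong_trans [trans]: "f \<simeq>\<^sub>J g \<Longrightarrow> g \<simeq>\<^sub>J k \<Longrightarrow> f \<simeq>\<^sub>J k"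
  using add_mem[of "f - g" "g - k"] by (simp add: cong_mod_def)

lemma cong_mult_left: "mpoly_vars c \<subseteq> A \<Longrightarrow> f \<simeq>\<^sub>J g \<Longrightarrow> c * f \<simeq>\<^sub>J c * g"
  using mult_mem[of c "f - g"] by (simp add: cong_mod_def algebra_simps)

lemma cong_mult:
  assumes "mpoly_vars f \<subseteq> A" "mpoly_vars g' \<subseteq> A" "f \<simeq>\<^sub>J f'" "g \<simeq>\<^sub>J g'"
  shows "f * g \<simeq>\<^sub>J f' * g'"
proof -
  have "f * g \<simeq>\<^sub>J f * g'"
    by (intro cong_mult_left assms)
  also have "f * g' \<simeq>\<^sub>J f' * g'"
    using cong_mult_left[OF assms(2,3)] by (simp add: mult.commute)
  finally show ?thesis .
qed

end

text \<open>The function \<open>wt\<close> is the degree of monomials with respect to the weights \<open>w\<close> of the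
  variables.\<close>

lemma subst_monom_single:
  fixes w :: "'x \<Rightarrow> nat"
  obtains wt where "\<And>m c. mpoly_subst (\<lambda>z. Polynomial.monom (1::'a::comm_ring_1) (w z))
    (Poly_Mapping.single m c) = Polynomial.monom c (wt m)"
proof -
  have *: "(\<Prod>z\<in>B. Polynomial.monom (1::'a) (w z) ^ F z) = Polynomial.monom 1 (\<Sum>z\<in>B. w z * F z)"
    for B :: "'x set" and F
    by (induction B rule: infinite_finite_induct) (simp_all add: monom_power mult_monom)
  show ?thesis
    by (rule that) (simp add: mpoly_subst_single * smult_monom)
qed

text \<open>The coefficients of \<open>f\<close> at the monomials of one weight \<open>i\<close> add up to the
  coefficient of \<open>t^i\<close> in the image of \<open>f\<close>, hence to zero. Replacing every monomial of \<open>f\<close> by a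
  fixed monomial of the same weight therefore changes \<open>f\<close> into \<open>0\<close>, and by hypothesis it does not
  change the class of \<open>f\<close> modulo \<open>J\<close>.\<close>

lemma (in mpoly_ideal) kernel_subset:
  fixes w :: "'x \<Rightarrow> nat"
  defines "\<Phi> \<equiv> mpoly_subst (\<lambda>z. Polynomial.monom 1 (w z))"
  assumes cong: "\<And>m m'. Poly_Mapping.keys m \<subseteq> A \<Longrightarrow> Poly_Mapping.keys m' \<subseteq> A \<Longrightarrow>
      \<Phi> (Poly_Mapping.single m 1) = \<Phi> (Poly_Mapping.single m' 1) \<Longrightarrow>
      Poly_Mapping.single m 1 \<simeq>\<^sub>J Poly_Mapping.single m' 1"
    and f: "mpoly_vars f \<subseteq> A" "\<Phi> f = 0"
  shows "f \<in> J"
proof -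
  obtain wt where wt: "\<And>m c. \<Phi> (Poly_Mapping.single m c) = Polynomial.monom c (wt m)"
    unfolding \<Phi>_def using subst_monom_single[of w] by blast
  let ?K = "Poly_Mapping.keys f"
  let ?c = "Poly_Mapping.lookup f"
  have keys: "Poly_Mapping.keys m \<subseteq> A" if "m \<in> ?K" for m
    using f(1) that by (auto simp: mpoly_vars_def)
  define rep where "rep i = (SOME m. m \<in> ?K \<and> wt m = i)" for i
  have rep: "rep (wt m) \<in> ?K" "wt (rep (wt m)) = wt m" if "m \<in> ?K" for m
    using someI[of "\<lambda>m'. m' \<in> ?K \<and> wt m' = wt m" m] that by (auto simp: rep_def)
  have "Poly_Mapping.single m (?c m) - Poly_Mapping.single (rep (wt m)) (?c m) \<in> J"
    if m: "m \<in> ?K" for m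
  proof -
    have "Poly_Mapping.single m 1 \<simeq>\<^sub>J Poly_Mapping.single (rep (wt m)) 1"
      by (intro cong keys m rep) (simp add: wt rep m)
    moreover have "mpoly_vars (Poly_Mapping.single 0 (?c m)) \<subseteq> A"
      by (intro mpoly_vars_single_subset) simp
    ultimately have "Poly_Mapping.single 0 (?c m) * Poly_Mapping.single m 1
        \<simeq>\<^sub>J Poly_Mapping.single 0 (?c m) * Poly_Mapping.single (rep (wt m)) 1"
      by (intro cong_mult_left)
    thus ?thesis
      by (simp add: Poly_Mapping.mult_single cong_mod_def)
  qed
  hence "(\<Sum>m\<in>?K. Poly_Mapping.single m (?c m) - Poly_Mapping.single (rep (wt m)) (?c m)) \<in> J"
    by (rule sum_mem)
  moreover have "(\<Sum>m\<in>?K. Poly_Mapping.single (rep (wt m)) (?c m)) = 0"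
  proof -
    have "\<Phi> f = (\<Sum>m\<in>?K. Polynomial.monom (?c m) (wt m))"
      by (subst mpoly_as_sum) (simp add: \<Phi>_def mpoly_subst_sum wt[unfolded \<Phi>_def])
    hence coeff: "(\<Sum>m | m \<in> ?K \<and> wt m = i. ?c m) = 0" for i
      using arg_cong[OF f(2), of "\<lambda>P. Polynomial.coeff P i"]
      by (simp add: Polynomial.coeff_sum sum.inter_filter)
    have "(\<Sum>m\<in>?K. Poly_Mapping.single (rep (wt m)) (?c m)) =
        (\<Sum>i\<in>wt ` ?K. \<Sum>m | m \<in> ?K \<and> wt m = i. Poly_Mapping.single (rep (wt m)) (?c m))"
      by (rule sum.image_gen) simp
    also have "\<dots> = (\<Sum>i\<in>wt ` ?K. Poly_Mapping.single (rep i) (\<Sum>m | m \<in> ?K \<and> wt m = i. ?c m))"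
      by (intro sum.cong refl) (simp add: single_sum)
    finally show ?thesis
      by (simp add: coeff)
  qed
  ultimately show ?thesis
    by (simp add: sum_subtractf mpoly_as_sum[symmetric])
qed


section \<open>Normal forms of monomials\<close>

definition uv :: "nat \<Rightarrow> nat \<Rightarrow> (gen_var, 'k::field) mpoly" where
  "uv a b = mvar U ^ a * mvar V ^ b"

text \<open>The value \<open>1\<close> at the index \<open>0\<close> lets \<open>uv a b * gen i\<close> also stand for the monomials in
  \<open>u\<close> and \<open>v\<close> alone, so that the normal forms need no case distinction.\<close>

definition gen :: "nat \<Rightarrow> (gen_var, 'k::field) mpoly" where
  "gen i = (if i = 0 then 1 else mvar (W i))"

lemma uv_mult: "uv a b * uv c d = uv (a + c) (b + d)"
  by (simp add: uv_def power_add ac_simps)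

lemma uv_mult_left: "uv a b * (uv c d * f) = uv (a + c) (b + d) * f"
  by (simp add: uv_mult mult.assoc[symmetric])

text \<open>The values \<open>x 0\<close> and \<open>y 0\<close> belong to \<open>gen 0 = 1\<close>, whose weight \<open>0\<close> is
  \<open>pq - 0 p - p q\<close>; monotonicity of \<open>x\<close> and \<open>y\<close> extends to the index \<open>0\<close>, whereas the bound
  \<open>2 y\<^sub>i \<le> p\<close> does not.\<close>

locale KW_relations = mpoly_ideal A J
  for A :: "gen_var set" and J :: "(gen_var, 'k::field) mpoly set" +
  fixes p q m :: nat and x y :: "nat \<Rightarrow> nat"
  assumes A: "A = {U, V} \<union> W ` {1..m}"
    and m: "1 \<le> m"
    and x0: "x 0 = 0" and y0: "y 0 = p"
    and x_mono: "\<And>i j. i < j \<Longrightarrow> j \<le> m \<Longrightarrow> x i < x j"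
    and y_mono: "\<And>i j. i < j \<Longrightarrow> j \<le> m \<Longrightarrow> y j < y i"
    and x_le: "\<And>i. i \<le> m \<Longrightarrow> 2 * x i \<le> q"
    and y_le: "\<And>i. 1 \<le> i \<Longrightarrow> i \<le> m \<Longrightarrow> 2 * y i \<le> p"
    and product: "\<And>i j. 1 \<le> i \<Longrightarrow> i \<le> j \<Longrightarrow> j \<le> m \<Longrightarrow>
      gen i * gen j \<simeq>\<^sub>J uv (q - x i - x j) (p - y i - y j)"
    and exchange: "\<And>i j. 1 \<le> i \<Longrightarrow> i < j \<Longrightarrow> j \<le> m \<Longrightarrow>
      uv 0 (y i - y j) * gen i \<simeq>\<^sub>J uv (x j - x i) 0 * gen j"
    and first: "uv 0 (p - y 1) \<simeq>\<^sub>J uv (x 1) 0 * gen 1"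
    and last: "uv (q - x m) 0 \<simeq>\<^sub>J uv 0 (y m) * gen m"
begin

lemma vars_uv: "mpoly_vars (uv a b) \<subseteq> A"
  unfolding uv_def by (intro mpoly_vars_times_subset mpoly_vars_power_subset) (simp_all add: A)

lemma vars_gen: "i \<le> m \<Longrightarrow> mpoly_vars (gen i) \<subseteq> A"
  by (auto simp: gen_def A)

lemma product': "1 \<le> i \<Longrightarrow> i \<le> m \<Longrightarrow> 1 \<le> j \<Longrightarrow> j \<le> m \<Longrightarrow>
    gen i * gen j \<simeq>\<^sub>J uv (q - x i - x j) (p - y i - y j)"
  using product[of i j] product[of j i]
  by (cases "i \<le> j") (simp_all add: mult.commute add.commute)

text \<open>At the index \<open>0\<close> the exchange relation reads \<open>v^(p - y\<^sub>j) = u^(x\<^sub>j) u\<^sub>j\<close>; it is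
  composed of the one between \<open>0\<close> and \<open>1\<close> and the one between \<open>1\<close> and \<open>j\<close>.\<close>

lemma exchange':
  assumes "i < j" "j \<le> m"
  shows "uv 0 (y i - y j) * gen i \<simeq>\<^sub>J uv (x j - x i) 0 * gen j"
proof (cases "i = 0")
  case False
  thus ?thesis
    using exchange assms by simp
next
  case True
  have j: "x 1 \<le> x j" "y j \<le> y 1" "y 1 < p"
    using x_mono[of 1 j] y_mono[of 1 j] y_mono[of 0 1] assms True y0 m
    by (cases "j = 1"; force)+
  have "uv 0 (p - y j) = uv 0 (y 1 - y j) * (uv 0 (p - y 1) :: (gen_var, 'k) mpoly)"
    using j by (simp add: uv_mult)
  also have "\<dots> \<simeq>\<^sub>J uv 0 (y 1 - y j) * (uv (x 1) 0 * gen 1)"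
    by (intro cong_mult_left vars_uv first)
  also have "\<dots> = uv (x 1) 0 * (uv 0 (y 1 - y j) * (gen 1 :: (gen_var, 'k) mpoly))"
    by (simp add: ac_simps)
  also have "\<dots> \<simeq>\<^sub>J uv (x 1) 0 * (uv (x j - x 1) 0 * gen j)"
  proof (intro cong_mult_left vars_uv)
    show "uv 0 (y 1 - y j) * gen 1 \<simeq>\<^sub>J uv (x j - x 1) 0 * gen j"
      using exchange[of 1 j] assms True by (cases "j = 1") (simp_all add: cong_refl)
  qed
  also have "\<dots> = uv (x j) 0 * (gen j :: (gen_var, 'k) mpoly)"
    using j by (simp add: uv_mult_left)
  finally show ?thesis
    using True by (simp add: gen_def x0 y0)
qed

text \<open>If \<open>i < j\<close>, then \<open>c = a + (x\<^sub>j - x\<^sub>i)\<close> and \<open>b = d + (y\<^sub>i - y\<^sub>j)\<close>, so the two normal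
  forms are \<open>u^a v^d\<close> times the two sides of an exchange relation.\<close>

lemma normal_same:
  assumes "i \<le> m" "j \<le> m" "a + x j = c + x i" "b + y j = d + y i"
  shows "uv a b * gen i \<simeq>\<^sub>J uv c d * gen j"
proof -
  have less: "uv a b * gen i \<simeq>\<^sub>J uv c d * gen j"
    if ij: "i < j" "j \<le> m" "a + x j = c + x i" "b + y j = d + y i" for a b c d i j
  proof -
    have "uv a d * (uv 0 (y i - y j) * gen i) \<simeq>\<^sub>J uv a d * (uv (x j - x i) 0 * gen j)"
      by (intro cong_mult_left vars_uv exchange' ij)
    moreover have "a + (x j - x i) = c" "d + (y i - y j) = b"
      using ij x_mono[of i j] y_mono[of i j] by auto
    ultimately show ?thesis
      by (simp add: uv_mult_left)
  qed
  consider "i < j" | "j < i" | "i = j"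
    by linarith
  thus ?thesis
  proof cases
    case 1
    thus ?thesis using less assms by blast
  next
    case 2
    thus ?thesis using assms by (intro cong_sym[OF less[of j i c a d b]]) auto
  next
    case 3
    thus ?thesis using assms by (simp add: cong_refl)
  qed
qed

text \<open>The induction on \<open>t\<close> uses \<open>u^(q - x\<^sub>m) = v^y\<^sub>m u\<^sub>m\<close>. It applies as soon as
  \<open>t > 0\<close>, because then \<open>a \<ge> q + x\<^sub>i - x\<^sub>j \<ge> q - x\<^sub>m\<close>. If \<open>i = 0\<close>, it replaces \<open>u\<^sub>0 = 1\<close> by
  \<open>u\<^sub>m\<close> and lowers \<open>t\<close> by one. If \<open>i > 0\<close>, it produces the product
  \<open>u\<^sub>i u\<^sub>m\<close>, which is a monomial in \<open>u\<close> and \<open>v\<close>; this leaves \<open>t\<close> as it is but leads to the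
  case \<open>i = 0\<close>.\<close>

lemma normal_shift:
  assumes "i \<le> m" "j \<le> m" "a + x j = c + x i + t * q" "b + y j + t * p = d + y i"
  shows "uv a b * gen i \<simeq>\<^sub>J uv c d * gen j"
  using assms
proof (induction t arbitrary: a b i)
  case 0
  thus ?case using normal_same by simp
next
  case (Suc t)
  have xjm: "x k \<le> x m" if "k \<le> m" for k
    using x_mono[of k m] that by (cases "k = m") auto
  have xm: "2 * x m \<le> q"
    using x_le by simp
  have zero: "uv a b * gen 0 \<simeq>\<^sub>J uv c d * gen j"
    if ab: "a + x j = c + Suc t * q" "b + y j + Suc t * p = d + p" for a b
  proof -
    have le: "q - x m \<le> a"
      using ab(1) xjm[OF Suc.prems(2)] by simp
    have "uv a b * gen 0 = uv (a - (q - x m)) b * (uv (q - x m) 0 :: (gen_var, 'k) mpoly)"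
      using le by (simp add: gen_def uv_mult)
    also have "\<dots> \<simeq>\<^sub>J uv (a - (q - x m)) b * (uv 0 (y m) * gen m)"
      by (intro cong_mult_left vars_uv last)
    also have "\<dots> = uv (a - (q - x m)) (b + y m) * (gen m :: (gen_var, 'k) mpoly)"
      by (simp add: uv_mult_left)
    also have "\<dots> \<simeq>\<^sub>J uv c d * gen j"
      by (rule Suc.IH) (use ab le xm Suc.prems(2) in auto)
    finally show ?thesis .
  qed
  show ?case
  proof (cases "i = 0")
    case True
    thus ?thesis
      using zero[of a b] Suc.prems by (simp add: x0 y0)
  next
    case False
    have le: "q - x m \<le> a" "x i \<le> a"
      using Suc.prems(3) xjm[OF Suc.prems(2)] xjm[OF Suc.prems(1)] xm by auto
    have ym: "y i + y m \<le> p"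
      using y_le[of i] y_le[of m] False Suc.prems(1) m by simp
    have "uv a b * gen i = uv (a - (q - x m)) b * gen i * (uv (q - x m) 0 :: (gen_var, 'k) mpoly)"
      using le by (simp add: uv_mult ac_simps)
    also have "\<dots> \<simeq>\<^sub>J uv (a - (q - x m)) b * gen i * (uv 0 (y m) * gen m)"
      by (intro cong_mult_left mpoly_vars_times_subset vars_uv vars_gen last Suc.prems)
    also have "\<dots> = uv (a - (q - x m)) (b + y m) * (gen i * (gen m :: (gen_var, 'k) mpoly))"
      by (simp add: uv_mult[of _ _ 0 "y m", simplified, symmetric] ac_simps)
    also have "\<dots> \<simeq>\<^sub>J uv (a - (q - x m)) (b + y m) * uv (q - x i - x m) (p - y i - y m)"
      using product'[of i m] False Suc.prems(1) m by (intro cong_mult_left vars_uv) auto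
    also have "\<dots> = uv (a - x i) (b + (p - y i)) * (gen 0 :: (gen_var, 'k) mpoly)"
    proof -
      have "a - (q - x m) + (q - x i - x m) = a - x i" "y m + (p - y i - y m) = p - y i"
        using le ym xm xjm[OF Suc.prems(1)] by auto
      thus ?thesis
        by (simp add: uv_mult gen_def add.assoc)
    qed
    also have "\<dots> \<simeq>\<^sub>J uv c d * gen j"
      by (rule zero) (use Suc.prems le ym in auto)
    finally show ?thesis .
  qed
qed

text \<open>Equality of the weights says \<open>\<alpha> p = \<beta> q\<close>, where \<open>(\<alpha>, -\<beta>)\<close> is the difference of the
  vectors \<open>(a - x\<^sub>i, b - y\<^sub>i)\<close> and \<open>(c - x\<^sub>j, d - y\<^sub>j)\<close>. Coprimality gives \<open>\<alpha> = t q\<close> and \<open>\<beta> = t p\<close>,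
  and the sign of \<open>t\<close> decides which of the two normal forms is rewritten.\<close>

lemma normal_unique:
  fixes h :: "nat \<Rightarrow> nat"
  assumes "coprime p q" "0 < p" "0 < q"
    and h: "\<And>i. i \<le> m \<Longrightarrow> h i + x i * p + y i * q = p * q"
    and ij: "i \<le> m" "j \<le> m"
    and eq: "a * p + b * q + h i = c * p + d * q + h j"
  shows "uv a b * gen i \<simeq>\<^sub>J uv c d * gen j"
proof -
  have hi: "int (h k) = int p * int q - int (x k) * int p - int (y k) * int q" if "k \<le> m" for k
    using arg_cong[OF h[OF that], of int] by simp
  let ?\<alpha> = "int a + int (x j) - int c - int (x i)"
  let ?\<beta> = "int d + int (y i) - int b - int (y j)"
  have key: "?\<alpha> * int p = ?\<beta> * int q"
    using arg_cong[OF eq, of int] by (simp add: hi ij algebra_simps)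
  hence "int q dvd ?\<alpha> * int p"
    by simp
  hence "int q dvd ?\<alpha>"
    using assms(1) by (simp add: coprime_dvd_mult_left_iff coprime_commute)
  then obtain t where t: "?\<alpha> = int q * t" ..
  with key have t': "?\<beta> = int p * t"
    using assms(3) by (simp add: ac_simps)
  show ?thesis
  proof (cases "0 \<le> t")
    case True
    then obtain s where s: "t = int s"
      using nonneg_int_cases by blast
    have "int (a + x j) = int (c + x i + s * q)" "int (b + y j + s * p) = int (d + y i)"
      using t t' s by (simp_all add: algebra_simps)
    thus ?thesis
      by (intro normal_shift[of i j a c s b d] ij) (simp_all only: of_nat_eq_iff)
  next
    case False
    define s where "s = nat (- t)"
    have s: "t = - int s"
      using False by (simp add: s_def)
    have "int (c + x i) = int (a + x j + s * q)" "int (d + y i + s * p) = int (b + y j)"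
      using t t' s by (simp_all add: algebra_simps)
    thus ?thesis
      by (intro cong_sym[OF normal_shift[of j i c a s d b]] ij) (simp_all only: of_nat_eq_iff)
  qed
qed

text \<open>Normal forms are closed under multiplication up to congruence, since a product of two
  generators with positive indices is congruent to a monomial in \<open>u\<close> and \<open>v\<close>. Hence every monomial
  has a normal form. The condition on the variables keeps all factors in the ring of which \<open>J\<close> is
  an ideal.\<close>

definition normalizable :: "(gen_var, 'k) mpoly \<Rightarrow> bool" where
  "normalizable f \<longleftrightarrow> mpoly_vars f \<subseteq> A \<and> (\<exists>a b i. i \<le> m \<and> f \<simeq>\<^sub>J uv a b * gen i)"

lemma normalizable_uv_gen: "i \<le> m \<Longrightarrow> normalizable (uv a b * gen i)"
  unfolding normalizable_def
  using mpoly_vars_times_subset[OF vars_uv vars_gen, of i a b] cong_refl[of "uv a b * gen i"] by metis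

lemma normalizable_mult:
  assumes "normalizable f" "normalizable g"
  shows "normalizable (f * g)"
proof -
  obtain a b i c d j where f: "i \<le> m" "f \<simeq>\<^sub>J uv a b * gen i" and g: "j \<le> m" "g \<simeq>\<^sub>J uv c d * gen j"
    using assms unfolding normalizable_def by blast
  have "f * g \<simeq>\<^sub>J (uv a b * gen i) * (uv c d * gen j)"
    using assms f g unfolding normalizable_def
    by (intro cong_mult mpoly_vars_times_subset vars_uv vars_gen) auto
  also have "\<dots> = uv (a + c) (b + d) * (gen i * gen j :: (gen_var, 'k) mpoly)"
    by (simp add: uv_mult[symmetric] ac_simps)
  finally have fg: "f * g \<simeq>\<^sub>J uv (a + c) (b + d) * (gen i * gen j)" .
  have "\<exists>a' b' k. k \<le> m \<and> gen i * gen j \<simeq>\<^sub>J uv a' b' * gen k"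
  proof (cases "i = 0 \<or> j = 0")
    case True
    hence "gen i * gen j = uv 0 0 * (gen (i + j) :: (gen_var, 'k) mpoly)" "i + j \<le> m"
      using f g by (auto simp: gen_def uv_def)
    thus ?thesis
      using cong_refl by metis
  next
    case False
    hence "gen i * gen j \<simeq>\<^sub>J uv (q - x i - x j) (p - y i - y j) * gen 0"
      using product'[of i j] f g by (simp add: gen_def)
    thus ?thesis
      by blast
  qed
  then obtain a' b' k where "k \<le> m" "gen i * gen j \<simeq>\<^sub>J uv a' b' * gen k"
    by blast
  hence "f * g \<simeq>\<^sub>J uv (a + c + a') (b + d + b') * gen k"
    using cong_trans[OF fg] cong_mult_left[OF vars_uv] by (metis uv_mult_left)
  thus ?thesis
    using assms \<open>k \<le> m\<close> mpoly_vars_times_subset[of f A g] unfolding normalizable_def by blast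
qed

lemma normalizable_single:
  assumes "Poly_Mapping.keys M \<subseteq> A"
  shows "normalizable (Poly_Mapping.single M 1)"
proof -
  have one: "normalizable 1"
    using normalizable_uv_gen[of 0 0 0] by (simp add: uv_def gen_def)
  have pow: "normalizable (f ^ k)" if "normalizable f" for f k
    by (induction k) (use that one normalizable_mult in auto)
  have var: "normalizable (mvar z)" if "z \<in> A" for z
  proof (cases z)
    case U
    thus ?thesis using normalizable_uv_gen[of 0 1 0] by (simp add: uv_def gen_def)
  next
    case V
    thus ?thesis using normalizable_uv_gen[of 0 0 1] by (simp add: uv_def gen_def)
  next
    case (W i)
    thus ?thesis using normalizable_uv_gen[of i 0 0] that by (auto simp: uv_def gen_def A)
  qed
  have "normalizable (\<Prod>z\<in>B. mvar z ^ k z)" if "B \<subseteq> A" for B k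
    using that by (induction B rule: infinite_finite_induct) (use one pow var normalizable_mult in auto)
  thus ?thesis
    using assms by (simp add: single_as_prod_mvar)
qed

end

section \<open>The defining ideal and the minors\<close>

lemma phi_uv: "phi p q h (uv a b) = Polynomial.monom 1 (a * p + b * q)"
  by (simp add: uv_def phi_def mpoly_subst_times mpoly_subst_power monom_power mult_monom ac_simps)

lemma phi_mvar_W: "phi p q h (mvar (W i)) = Polynomial.monom 1 (h i)"
  by (simp add: phi_def)

lemma phi_mult: "phi p q h (f * g) = phi p q h f * phi p q h g"
  by (simp add: phi_def mpoly_subst_times)

lemma phi_diff: "phi p q h (f - g) = phi p q h f - phi p q h g"
  by (simp add: phi_def mpoly_subst_diff)

lemma mem_defining_ideal:
  "f \<in> defining_ideal n p q h \<longleftrightarrow> mpoly_vars f \<subseteq> S_vars n \<and> phi p q h f = 0"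
  by (auto simp: defining_ideal_def a_kernel_def' S_ring_def mpoly_ring_simps
      ring_of_type_algebra_def)

lemma ideal_defining_ideal: "ideal (defining_ideal n p q h :: (gen_var, 'k::field) mpoly set) (S_ring n)"
proof -
  interpret ring_hom_cring "S_ring n" "ring_of_type_algebra :: 'k poly ring" "phi p q h"
    unfolding S_ring_def phi_def by (rule mpoly_subst_ring_hom)
  show ?thesis
    unfolding defining_ideal_def by (rule ring.kernel_is_ideal)
qed


text \<open>The inequalities between exponents make the truncated subtractions add up as they do over
  the integers, which brings the minors into the form of the relations above.\<close>

lemma minors_matrix_A:
  assumes "1 \<le> i" "i < j" "x i \<le> x j" "2 * x j \<le> q" "y j \<le> y i" "2 * y i \<le> p"
  shows "minors 2 (matrix_A p q x y i j :: (gen_var, 'k::field) mpoly mat) =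
    {gen i * gen j - uv (q - x i - x j) (p - y i - y j),
     uv 0 (y i - y j) * gen i - uv (x j - x i) 0 * gen j,
     uv (q - x j - x j) (p - y j - y j) - gen j * gen j}"
proof -
  have e: "uv (q - x i - x j) (p - y i - y j) = uv (q - 2 * x j) (p - y i - y j) * (uv (x j - x i) 0 :: (gen_var, 'k) mpoly)"
      "uv (q - x j - x j) (p - y j - y j) = uv (q - 2 * x j) (p - y i - y j) * (uv 0 (y i - y j) :: (gen_var, 'k) mpoly)"
    using assms by (simp_all add: uv_mult mult_2 add.commute)
  show ?thesis
    unfolding matrix_A_def Let_def minors_2_mat_of_rows_list e
    using assms by (simp add: gen_def uv_def ac_simps)
qed

lemma minors_matrix_B:
  assumes "3 \<le> n" "x 1 + x (n - 2) \<le> q" "y 1 + y (n - 2) \<le> p"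
  shows "minors 2 (matrix_B n p q x y :: (gen_var, 'k::field) mpoly mat) =
    {uv 0 (y (n - 2)) * gen (n - 2) - uv (q - x (n - 2)) 0,
     uv 0 (p - y 1) - uv (x 1) 0 * gen 1,
     uv (q - x 1 - x (n - 2)) (p - y 1 - y (n - 2)) - gen 1 * gen (n - 2)}"
proof -
  have e: "uv (q - x (n - 2)) 0 = uv (q - x 1 - x (n - 2)) 0 * (uv (x 1) 0 :: (gen_var, 'k) mpoly)"
      "uv 0 (p - y 1) = uv 0 (y (n - 2)) * (uv 0 (p - y 1 - y (n - 2)) :: (gen_var, 'k) mpoly)"
    using assms by (simp_all add: uv_mult mult_2 add.commute)
  show ?thesis
    unfolding matrix_B_def Let_def minors_2_mat_of_rows_list e
    using assms by (simp add: gen_def uv_def ac_simps)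
qed

lemma minors_matrix_C:
  assumes "3 \<le> n" "x 1 \<le> x (n - 2)" "x 1 + x (n - 2) \<le> q" "y (n - 2) \<le> y 1" "2 * y 1 \<le> p"
  shows "minors 2 (matrix_C n p q x y :: (gen_var, 'k::field) mpoly mat) =
    {uv (q - x 1 - x 1) (p - y 1 - y 1) - gen 1 * gen 1,
     uv (q - x 1 - x (n - 2)) (p - y 1 - y (n - 2)) - gen 1 * gen (n - 2),
     uv 0 (y 1 - y (n - 2)) * gen 1 - uv (x (n - 2) - x 1) 0 * gen (n - 2)}"
proof -
  have e: "uv (q - x 1 - x 1) (p - y 1 - y 1) = uv (q - x 1 - x (n - 2)) (p - 2 * y 1) * (uv (x (n - 2) - x 1) 0 :: (gen_var, 'k) mpoly)"
      "uv (q - x 1 - x (n - 2)) (p - y 1 - y (n - 2)) = uv (q - x 1 - x (n - 2)) (p - 2 * y 1) * (uv 0 (y 1 - y (n - 2)) :: (gen_var, 'k) mpoly)"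
    using assms by (simp_all add: uv_mult mult_2 add.commute)
  show ?thesis
    unfolding matrix_C_def Let_def minors_2_mat_of_rows_list e
    using assms by (simp add: gen_def uv_def ac_simps)
qed

text \<open>In the next two lemmas \<open>a\<close> and \<open>b\<close> are weights \<open>pq - x\<^sub>i p - y\<^sub>i q\<close>. The exchange relation
  is used beyond the generators as well: \<open>a = 0\<close> or \<open>b = 0\<close> with \<open>(x\<^sub>i, y\<^sub>i) = (0, p)\<close> or \<open>(q, 0)\<close>
  yields the two minors of \<open>B\<close> that compare a pure power of \<open>v\<close> or \<open>u\<close> with a multiple of a
  generator.\<close>

lemma weight_product:
  fixes p q :: nat
  assumes "a + x1 * p + y1 * q = p * q" "b + x2 * p + y2 * q = p * q" "x1 + x2 \<le> q" "y1 + y2 \<le> p"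
  shows "a + b = (q - x1 - x2) * p + (p - y1 - y2) * q"
proof -
  obtain c d where cd: "q = x1 + x2 + c" "p = y1 + y2 + d"
    using assms(3,4) by (metis le_iff_add)
  have "x1 * p + x2 * p + c * p = p * q" "y1 * q + y2 * q + d * q = p * q"
    using cd by (metis add_mult_distrib mult.commute, metis add_mult_distrib)
  moreover have "q - x1 - x2 = c" "p - y1 - y2 = d"
    using cd by simp_all
  ultimately show ?thesis
    using assms(1,2) by simp
qed

lemma weight_exchange:
  fixes p q :: nat
  assumes "a + x1 * p + y1 * q = p * q" "b + x2 * p + y2 * q = p * q" "x1 \<le> x2" "y2 \<le> y1"
  shows "(y1 - y2) * q + a = (x2 - x1) * p + b"
proof -
  obtain c d where "x2 = x1 + c" "y1 = y2 + d"
    using assms(3,4) by (metis le_iff_add)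
  thus ?thesis
    using assms(1,2) by (simp add: algebra_simps)
qed

theorem theorem4p1:
  fixes p q n :: nat and x y h :: "nat \<Rightarrow> nat" and H :: "nat set"
  assumes "3 \<le> p" and "p < q" and "coprime p q" and "3 \<le> n"
    and "\<And>i. i \<in> {1..n - 2} \<Longrightarrow> 0 < x i \<and> 0 < y i"
    and "strict_mono_on {1..n - 2} x"
    and "strict_antimono_on {1..n - 2} y"
    and "\<And>i. i \<in> {1..n - 2} \<Longrightarrow> 2 * x i \<le> q \<and> 2 * y i \<le> p"
    and "\<And>i. i \<in> {1..n - 2} \<Longrightarrow>
           int (h i) = int p * int q - int (x i) * int p - int (y i) * int q"
    and "H = submonoid_generated ({p, q} \<union> h ` {1..n - 2})"
    and "H \<in> KW p q"
  shows "(defining_ideal n p q h :: (gen_var, 'k::field) mpoly set) =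
    genideal (S_ring n)
      ((\<Union>j\<in>{1..n - 2}. \<Union>i\<in>{1..<j}. minors 2 (matrix_A p q x y i j)) \<union>
       minors 2 (matrix_B n p q x y) \<union>
       minors 2 (matrix_C n p q x y))"
proof -
  define m where "m = n - 2"
  have m: "1 \<le> m"
    using assms(4) by (simp add: m_def)
  have pos: "0 < x i" "0 < y i" and le: "2 * x i \<le> q" "2 * y i \<le> p" if "1 \<le> i" "i \<le> m" for i
    using assms(5,8)[of i] that by (simp_all add: m_def)
  have sum_le: "x i + x j \<le> q" "y i + y j \<le> p" if "1 \<le> i" "i \<le> m" "1 \<le> j" "j \<le> m" for i j
    using le[OF that(1,2)] le[OF that(3,4)] by auto
  have mono: "x i < x j" "y j < y i" if "1 \<le> i" "i < j" "j \<le> m" for i j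
    using assms(6,7) that unfolding monotone_on_def m_def by auto
  have mono1: "x 1 \<le> x m" "y m \<le> y 1"
    using mono[of 1 m] m by (cases "m = 1"; force)+
  have h: "h i + x i * p + y i * q = p * q" if "1 \<le> i" "i \<le> m" for i
  proof -
    have "int (h i + x i * p + y i * q) = int (p * q)"
      using assms(9)[of i] that by (simp add: m_def)
    thus ?thesis
      by (simp only: of_nat_eq_iff)
  qed

  let ?D = "defining_ideal n p q h :: (gen_var, 'k) mpoly set"
  let ?G = "(\<Union>j\<in>{1..n - 2}. \<Union>i\<in>{1..<j}. minors 2 (matrix_A p q x y i j)) \<union>
       minors 2 (matrix_B n p q x y) \<union> minors 2 (matrix_C n p q x y) :: (gen_var, 'k) mpoly set"
  define J where "J = genideal (S_ring n) ?G"
  have minors_A: "minors 2 (matrix_A p q x y i j :: (gen_var, 'k::field) mpoly mat) =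
    {gen i * gen j - uv (q - x i - x j) (p - y i - y j),
     uv 0 (y i - y j) * gen i - uv (x j - x i) 0 * gen j,
     uv (q - x j - x j) (p - y j - y j) - gen j * gen j}" if "1 \<le> i" "i < j" "j \<le> m" for i j
    using mono[OF that] le[of i] le[of j] that by (intro minors_matrix_A) auto
  have minors_B: "minors 2 (matrix_B n p q x y :: (gen_var, 'k::field) mpoly mat) =
    {uv 0 (y m) * gen m - uv (q - x m) 0,
     uv 0 (p - y 1) - uv (x 1) 0 * gen 1,
     uv (q - x 1 - x m) (p - y 1 - y m) - gen 1 * gen m}"
    using sum_le[of 1 m] m assms(4) unfolding m_def by (intro minors_matrix_B) auto
  have minors_C: "minors 2 (matrix_C n p q x y :: (gen_var, 'k::field) mpoly mat) =
    {uv (q - x 1 - x 1) (p - y 1 - y 1) - gen 1 * gen 1,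
     uv (q - x 1 - x m) (p - y 1 - y m) - gen 1 * gen m,
     uv 0 (y 1 - y m) * gen 1 - uv (x m - x 1) 0 * gen m}"
    using sum_le[of 1 m] mono1 le[of 1] m assms(4) unfolding m_def by (intro minors_matrix_C) auto

  have vars: "mpoly_vars (uv a b :: (gen_var, 'k) mpoly) \<subseteq> S_vars n"
      "i \<le> m \<Longrightarrow> mpoly_vars (gen i :: (gen_var, 'k) mpoly) \<subseteq> S_vars n" for a b i
    unfolding uv_def
    by (intro mpoly_vars_times_subset mpoly_vars_power_subset; simp add: S_vars_def)
       (auto simp: gen_def S_vars_def m_def)
  have phi_gen: "phi p q h (gen i :: (gen_var, 'k) mpoly) = Polynomial.monom 1 ((h(0 := 0)) i)" for i
    by (simp add: gen_def phi_mvar_W) (simp add: phi_def)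
  have diff_mem: "f - g \<in> ?D"
    if "mpoly_vars f \<subseteq> S_vars n" "mpoly_vars g \<subseteq> S_vars n" "phi p q h f = phi p q h g" for f g
    using that by (simp add: mem_defining_ideal mpoly_vars_diff_subset phi_diff)
  note phi_simps = phi_mult phi_uv phi_gen mult_monom

  have product_mem: "gen i * gen j - uv (q - x i - x j) (p - y i - y j) \<in> ?D"
      "uv (q - x i - x j) (p - y i - y j) - gen i * gen j \<in> ?D"
    if "1 \<le> i" "i \<le> m" "1 \<le> j" "j \<le> m" for i j
  proof -
    have "mpoly_vars (gen i * gen j :: (gen_var, 'k) mpoly) \<subseteq> S_vars n"
      using that by (intro mpoly_vars_times_subset vars)
    moreover have "phi p q h (gen i * gen j :: (gen_var, 'k) mpoly) =
        phi p q h (uv (q - x i - x j) (p - y i - y j))"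
      using weight_product[OF h[OF that(1,2)] h[OF that(3,4)] sum_le[OF that]] that
      by (simp add: phi_simps)
    ultimately show "gen i * gen j - uv (q - x i - x j) (p - y i - y j) \<in> ?D"
      "uv (q - x i - x j) (p - y i - y j) - gen i * gen j \<in> ?D"
      using vars(1) by (simp_all only: diff_mem)
  qed
  have exchange_mem: "uv 0 (y i - y j) * gen i - uv (x j - x i) 0 * gen j \<in> ?D"
    if "1 \<le> i" "i \<le> m" "1 \<le> j" "j \<le> m" "x i \<le> x j" "y j \<le> y i" for i j
    using weight_exchange[OF h[OF that(1,2)] h[OF that(3,4)] that(5,6)] that
    by (intro diff_mem mpoly_vars_times_subset vars) (simp_all add: phi_simps)
  have first_mem: "uv 0 (p - y 1) - uv (x 1) 0 * gen 1 \<in> ?D"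
    \<comment> \<open>the weight \<open>0\<close> of \<open>1\<close>, written as \<open>pq - 0 p - p q\<close>\<close>
    using weight_exchange[of 0 0 p p q "h 1" "x 1" "y 1"] h[of 1] le[of 1] m
    by (intro diff_mem mpoly_vars_times_subset vars) (simp_all add: phi_simps)
  have last_mem: "uv 0 (y m) * gen m - uv (q - x m) 0 \<in> ?D"
    \<comment> \<open>the weight \<open>0\<close> of \<open>1\<close>, written as \<open>pq - q p - 0 q\<close>\<close>
    using weight_exchange[of "h m" "x m" p "y m" q 0 q 0] h[of m] le[of m] m
    by (intro diff_mem mpoly_vars_times_subset vars) (simp_all add: phi_simps)
  have G_subset: "?G \<subseteq> ?D"
  proof -
    have "minors 2 (matrix_A p q x y i j) \<subseteq> ?D" if "1 \<le> i" "i < j" "j \<le> m" for i j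
      using that mono[OF that] product_mem[of i j] product_mem[of j j] exchange_mem[of i j]
      by (simp add: minors_A)
    moreover have "minors 2 (matrix_B n p q x y) \<subseteq> ?D" "minors 2 (matrix_C n p q x y) \<subseteq> ?D"
      using first_mem last_mem product_mem[of 1 m] product_mem[of 1 1] exchange_mem[of 1 m] m mono1
      by (simp_all add: minors_B minors_C)
    ultimately show ?thesis
      unfolding m_def by (intro Un_least UN_least) simp_all
  qed
  have ring: "ring (S_ring n :: (gen_var, 'k) mpoly ring)"
    unfolding S_ring_def using cring_mpoly_ring cring.axioms(1) by blast
  have G_carrier: "?G \<subseteq> carrier (S_ring n)"
    by (rule subset_trans[OF G_subset])
       (auto simp: mem_defining_ideal S_ring_def mpoly_ring_simps)
  have J_ideal: "ideal J (S_ring n)" and GJ: "?G \<subseteq> J"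
    unfolding J_def using ring.genideal_ideal[OF ring G_carrier] ring.genideal_self[OF ring G_carrier]
    by auto
  have JD: "J \<subseteq> ?D"
    unfolding J_def by (rule ring.genideal_minimal[OF ring ideal_defining_ideal G_subset])

  interpret mpoly_ideal "S_vars n" J
    by (rule mpoly_ideal.intro) (use J_ideal in \<open>simp add: S_ring_def\<close>)
  write cong_mod (infix "\<simeq>\<^sub>J" 50)
  have A_mem: "minors 2 (matrix_A p q x y i j) \<subseteq> J" if "1 \<le> i" "i < j" "j \<le> m" for i j
    using GJ that unfolding m_def by (force simp del: One_nat_def)
  have B_mem: "minors 2 (matrix_B n p q x y) \<subseteq> J" and C_mem: "minors 2 (matrix_C n p q x y) \<subseteq> J"
    using GJ by auto
  \<comment> \<open>For \<open>j > 1\<close> the square of \<open>u\<^sub>j\<close> occurs in the matrix \<open>A\<^sub>1\<^sub>j\<close>; the square of \<open>u\<^sub>1\<close> occurs in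
    no matrix \<open>A\<^sub>i\<^sub>j\<close> and comes from \<open>C\<close>.\<close>
  have product: "gen i * gen j \<simeq>\<^sub>J uv (q - x i - x j) (p - y i - y j)"
    if ij: "1 \<le> i" "i \<le> j" "j \<le> m" for i j
  proof -
    consider "i < j" | "i = j" "j = 1" | "i = j" "1 < j"
      using ij by (metis le_neq_implies_less)
    thus ?thesis
    proof cases
      case 1
      thus ?thesis using A_mem[of i j] ij by (simp add: minors_A cong_mod_def)
    next
      case 2
      thus ?thesis using C_mem by - (rule cong_sym, simp add: minors_C cong_mod_def)
    next
      case 3
      thus ?thesis using A_mem[of 1 j] ij by - (rule cong_sym, simp add: minors_A cong_mod_def)
    qed
  qed
  \<comment> \<open>The indices of the generators start at \<open>1\<close>, so the values of \<open>x\<close>, \<open>y\<close> and, further below, \<open>h\<close> at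
    \<open>0\<close> are free to be those of \<open>u\<^sub>0 = 1\<close>.\<close>
  interpret KW_relations "S_vars n" J p q m "x(0 := 0)" "y(0 := p)"
  proof
    show "S_vars n = {U, V} \<union> W ` {1..m}"
      by (simp add: S_vars_def m_def)
    show "(x(0 := 0)) i < (x(0 := 0)) j" if "i < j" "j \<le> m" for i j
      using that pos[of j] mono[of i j] by auto
    show "(y(0 := p)) j < (y(0 := p)) i" if "i < j" "j \<le> m" for i j
      using that pos[of j] le[of j] mono[of i j] by auto
    show "uv 0 ((y(0 := p)) i - (y(0 := p)) j) * gen i \<simeq>\<^sub>J uv ((x(0 := 0)) j - (x(0 := 0)) i) 0 * gen j"
      if "1 \<le> i" "i < j" "j \<le> m" for i j
      using A_mem[OF that] that by (simp add: minors_A cong_mod_def)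
    show "uv 0 (p - (y(0 := p)) 1) \<simeq>\<^sub>J uv ((x(0 := 0)) 1) 0 * gen 1"
      using B_mem by (simp add: minors_B cong_mod_def)
    show "uv (q - (x(0 := 0)) m) 0 \<simeq>\<^sub>J uv 0 ((y(0 := p)) m) * gen m"
      using B_mem m by - (rule cong_sym, simp add: minors_B cong_mod_def)
  qed (use m le product in auto)

  have "?D \<subseteq> J"
  proof
    fix f assume f: "f \<in> ?D"
    show "f \<in> J"
    proof (rule kernel_subset[of "weight p q h"])
      show "mpoly_vars f \<subseteq> S_vars n"
          "mpoly_subst (\<lambda>z. Polynomial.monom 1 (weight p q h z)) f = 0"
        using f by (simp_all add: mem_defining_ideal phi_def)
    next
      fix M N :: "gen_var \<Rightarrow>\<^sub>0 nat"
      assume MN: "Poly_Mapping.keys M \<subseteq> S_vars n" "Poly_Mapping.keys N \<subseteq> S_vars n"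
      assume "mpoly_subst (\<lambda>z. Polynomial.monom 1 (weight p q h z)) (Poly_Mapping.single M (1::'k)) =
        mpoly_subst (\<lambda>z. Polynomial.monom 1 (weight p q h z)) (Poly_Mapping.single N 1)"
      hence eq: "phi p q h (Poly_Mapping.single M (1::'k)) = phi p q h (Poly_Mapping.single N 1)"
        by (simp add: phi_def)
      obtain a b i c d j where i: "i \<le> m" "Poly_Mapping.single M 1 \<simeq>\<^sub>J uv a b * gen i"
        and j: "j \<le> m" "Poly_Mapping.single N 1 \<simeq>\<^sub>J uv c d * gen j"
        using normalizable_single MN unfolding normalizable_def by metis
      have phi_cong: "phi p q h f = phi p q h g" if "f \<simeq>\<^sub>J g" for f g
        using that JD by (auto simp: cong_mod_def mem_defining_ideal phi_diff)
      have "phi p q h (uv a b * gen i :: (gen_var, 'k) mpoly) = phi p q h (uv c d * gen j)"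
        using eq phi_cong[OF i(2)] phi_cong[OF j(2)] by simp
      hence "a * p + b * q + (h(0 := 0)) i = c * p + d * q + (h(0 := 0)) j"
        by (simp add: phi_simps monom_eq_iff' del: fun_upd_apply)
      hence "uv a b * gen i \<simeq>\<^sub>J uv c d * gen j"
        using assms(1-3) h i j by (intro normal_unique[where h = "h(0 := 0)"]) auto
      thus "Poly_Mapping.single M 1 \<simeq>\<^sub>J Poly_Mapping.single N 1"
        using i(2) j(2) cong_trans cong_sym by blast
    qed
  qed
  thus ?thesis
    using JD unfolding J_def by blast
qed

end
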